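(* Let $\alpha,\beta,\gamma\in(0,1]$ and, for $t,s\in[0,1]$, let $$G(t,s)=\begin{cases}\displaystyle\frac{t^{\alpha+\beta}}{\gamma}\left[\frac{s^{\gamma}}{\beta(\alpha+\beta)}-\frac{t^{\gamma}}{(\beta+\gamma)(\alpha+\beta+\gamma)}\right] & : t\le s,\\[2ex] \displaystyle\frac{s^{\beta+\gamma}}{\alpha}\left[\frac{t^{\alpha}}{\beta(\beta+\gamma)}-\frac{s^{\alpha}}{(\alpha+\beta)(\alpha+\beta+\gamma)}\right] & : s\le t.\end{cases}$$ Then for all $t,s\in[0,1]$, $$0\le G(t,s)\le G(1,s).$$
   Context: $G$ is the Green's function of the conformable fractional cantilever beam problem $D^{\delta}D^{\gamma}D^{\beta}D^{\alpha}x=0$, $x(0)=D^{\alpha}x(0)=D^{\beta}D^{\alpha}x(1)=D^{\gamma}D^{\beta}D^{\alpha}x(1)=0$ (with $\delta\in(0,1]$), but the claim only uses the explicit formula for $G$. *)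

theory Defs
  imports Complex_Main
begin

text \<open>
  Powers are \<^const>\<open>powr\<close>; since all exponents are positive, the convention
  \<^prop>\<open>0 powr a = (0::real)\<close> agrees with the usual one at \<open>t = 0\<close> and \<open>s = 0\<close>.
  The two branches overlap on \<open>t = s\<close>, where they agree (see \<open>beam_green_ge\<close>).
\<close>

definition beam_green :: "real \<Rightarrow> real \<Rightarrow> real \<Rightarrow> real \<Rightarrow> real \<Rightarrow> real" where
  "beam_green \<alpha> \<beta> \<gamma> t s =
     (if t \<le> s
      then t powr (\<alpha> + \<beta>) / \<gamma> *
             (s powr \<gamma> / (\<beta> * (\<alpha> + \<beta>)) - t powr \<gamma> / ((\<beta> + \<gamma>) * (\<alpha> + \<beta> + \<gamma>)))
      else s powr (\<beta> + \<gamma>) / \<alpha> *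
             (t powr \<alpha> / (\<beta> * (\<beta> + \<gamma>)) - s powr \<alpha> / ((\<alpha> + \<beta>) * (\<alpha> + \<beta> + \<gamma>))))"

lemma beam_green_ge:
  fixes \<alpha> \<beta> \<gamma> t s :: real
  assumes pos: "0 < \<alpha>" "0 < \<beta>" "0 < \<gamma>" and le: "s \<le> t"
  shows "beam_green \<alpha> \<beta> \<gamma> t s =
           s powr (\<beta> + \<gamma>) / \<alpha> *
             (t powr \<alpha> / (\<beta> * (\<beta> + \<gamma>)) - s powr \<alpha> / ((\<alpha> + \<beta>) * (\<alpha> + \<beta> + \<gamma>)))"
proof (cases "s = t")
  case True
  have nz: "\<alpha> \<noteq> 0" "\<beta> \<noteq> 0" "\<gamma> \<noteq> 0" "\<alpha> + \<beta> \<noteq> 0" "\<beta> + \<gamma> \<noteq> 0" "\<alpha> + \<beta> + \<gamma> \<noteq> 0"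
    using pos by auto
  have eq: "a * b / \<gamma> * (c / (\<beta> * (\<alpha> + \<beta>)) - c / ((\<beta> + \<gamma>) * (\<alpha> + \<beta> + \<gamma>))) =
            b * c / \<alpha> * (a / (\<beta> * (\<beta> + \<gamma>)) - a / ((\<alpha> + \<beta>) * (\<alpha> + \<beta> + \<gamma>)))"
    for a b c :: real
  proof -
    have "1 / \<gamma> * (1 / (\<beta> * (\<alpha> + \<beta>)) - 1 / ((\<beta> + \<gamma>) * (\<alpha> + \<beta> + \<gamma>))) =
          1 / \<alpha> * (1 / (\<beta> * (\<beta> + \<gamma>)) - 1 / ((\<alpha> + \<beta>) * (\<alpha> + \<beta> + \<gamma>)))"
      using nz by (simp add: divide_simps) algebra
    from arg_cong[OF this, of "\<lambda>x. a * b * c * x"] show ?thesis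
      by (simp add: algebra_simps)
  qed
  show ?thesis
    using eq[of "t powr \<alpha>" "t powr \<beta>" "t powr \<gamma>"] True
    by (simp add: beam_green_def powr_add)
next
  case False
  with le show ?thesis by (simp add: beam_green_def)
qed

end

theory Submission
  imports Defs "HOL-Analysis.Convex"
begin

text \<open>
  For fixed \<open>s\<close> the function \<open>t \<mapsto> G(t, s)\<close> increases up to \<open>G(1, s)\<close>. On \<open>[s, 1]\<close>
  this is visible from the formula, since \<open>t\<close> enters only through \<open>t powr \<alpha>\<close> with a positive
  coefficient. On \<open>[0, s]\<close> the two occurrences of \<open>t\<close> compete. There it suffices to compare
  with the diagonal value \<open>G(s, s)\<close>, because the second range leads on to \<open>G(1, s)\<close>, and
  this comparison comes from Young's inequality for the mixed term
  \<open>t powr (\<alpha> + \<beta>) * s powr \<gamma>\<close> (lemma \<open>bracket_le_diagonal\<close>), with no differentiation.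

  Positivity holds because in both branches the bracket subtracts a smaller power over a larger
  denominator.
\<close>

lemma diff_divide_nonneg:
  fixes x y p q :: real
  assumes "0 \<le> y" "y \<le> x" "0 < p" "p \<le> q"
  shows "0 \<le> x / p - y / q"
  using frac_le[of x y p q] assms by simp

lemma powr_mult_powr_le_weighted_sum:
  fixes a c t s :: real
  assumes "0 < a" "0 < c" "0 < t" "0 < s"
  shows "(a + c) * (t powr a * s powr c) \<le> a * t powr (a + c) + c * s powr (a + c)"
proof -
  have "(t powr (a + c)) powr (a / (a + c)) * (s powr (a + c)) powr (c / (a + c))
      \<le> a / (a + c) * t powr (a + c) + c / (a + c) * s powr (a + c)"
    using assms by (intro Youngs_inequality_0) (auto simp: add_divide_distrib[symmetric])
  hence "t powr a * s powr c \<le> (a * t powr (a + c) + c * s powr (a + c)) / (a + c)"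
    using assms by (simp add: powr_powr add_divide_distrib)
  thus ?thesis
    using assms by (simp add: pos_le_divide_eq mult.commute)
qed

text \<open>
  The right-hand side is the left-hand side at \<open>t = s\<close>. Young's inequality bounds the mixed term
  \<open>t powr a * s powr c\<close> by pure powers of \<open>t\<close> and \<open>s\<close> and is sharp at \<open>t = s\<close>;
  afterwards \<open>t powr (a + c)\<close> has a nonnegative coefficient and may be replaced by
  \<open>s powr (a + c)\<close>.
\<close>

lemma bracket_le_diagonal:
  fixes a b c t s :: real
  assumes "0 < a" "0 < b" "0 < c" "0 \<le> t" "t \<le> s"
  shows "t powr a * (s powr c / (b * a) - t powr c / ((b + c) * (a + c)))
       \<le> s powr a * (s powr c / (b * a) - s powr c / ((b + c) * (a + c)))"
proof (cases "t = 0")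
  case True
  have "0 \<le> s powr c / (b * a) - s powr c / ((b + c) * (a + c))"
    using assms by (intro diff_divide_nonneg mult_mono) auto
  with True show ?thesis by simp
next
  case False
  with assms have "0 < t" "0 < s" by auto
  define P T S where "P = t powr a * s powr c" and "T = t powr (a + c)" and "S = s powr (a + c)"
  have young: "0 \<le> a * T + c * S - (a + c) * P"
    using powr_mult_powr_le_weighted_sum[of a c t s] assms \<open>0 < t\<close> \<open>0 < s\<close>
    by (simp add: P_def T_def S_def)
  have "T \<le> S"
    using assms by (simp add: T_def S_def powr_mono2)
  have coeff: "0 \<le> 1 / (b * (a + c)) - 1 / ((b + c) * (a + c))"
    using assms by (intro diff_divide_nonneg mult_mono) auto
  \<comment> \<open>The gap between the two sides, split into the defect in Young's inequality and the
      defect in \<open>T \<le> S\<close>.\<close>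
  have "(S / (b * a) - S / ((b + c) * (a + c))) - (P / (b * a) - T / ((b + c) * (a + c)))
      = (a * T + c * S - (a + c) * P) / (b * a * (a + c))
        + (S - T) * (1 / (b * (a + c)) - 1 / ((b + c) * (a + c)))"
  proof -
    have "a \<noteq> 0" "b \<noteq> 0" "b + c \<noteq> 0" "a + c \<noteq> 0" using assms by auto
    thus ?thesis by (simp add: divide_simps) algebra
  qed
  also have "\<dots> \<ge> 0"
    using young coeff \<open>T \<le> S\<close> assms by simp
  finally show ?thesis
    by (simp add: P_def T_def S_def powr_add right_diff_distrib)
qed

lemma beam_green_nonneg:
  assumes "0 < \<alpha>" "0 < \<beta>" "0 < \<gamma>" "0 \<le> t" "0 \<le> s"
  shows "0 \<le> beam_green \<alpha> \<beta> \<gamma> t s"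
proof (cases "t \<le> s")
  case True
  have "0 \<le> s powr \<gamma> / (\<beta> * (\<alpha> + \<beta>)) - t powr \<gamma> / ((\<beta> + \<gamma>) * (\<alpha> + \<beta> + \<gamma>))"
    using assms True by (intro diff_divide_nonneg mult_mono powr_mono2) auto
  with True assms show ?thesis by (simp add: beam_green_def)
next
  case False
  have "0 \<le> t powr \<alpha> / (\<beta> * (\<beta> + \<gamma>)) - s powr \<alpha> / ((\<alpha> + \<beta>) * (\<alpha> + \<beta> + \<gamma>))"
    using assms False by (intro diff_divide_nonneg mult_mono powr_mono2) auto
  with False assms show ?thesis by (simp add: beam_green_def)
qed

lemma beam_green_le_diagonal:
  assumes "0 < \<alpha>" "0 < \<beta>" "0 < \<gamma>" "0 \<le> t" "t \<le> s"
  shows "beam_green \<alpha> \<beta> \<gamma> t s \<le> beam_green \<alpha> \<beta> \<gamma> s s"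
  using divide_right_mono[OF bracket_le_diagonal[of "\<alpha> + \<beta>" \<beta> \<gamma> t s], of \<gamma>] assms
  by (simp add: beam_green_def)

lemma beam_green_mono_above_diagonal:
  assumes "0 < \<alpha>" "0 < \<beta>" "0 < \<gamma>" "0 \<le> s" "s \<le> t" "t \<le> u"
  shows "beam_green \<alpha> \<beta> \<gamma> t s \<le> beam_green \<alpha> \<beta> \<gamma> u s"
proof -
  have "t powr \<alpha> \<le> u powr \<alpha>"
    using assms by (intro powr_mono2) auto
  hence "t powr \<alpha> / (\<beta> * (\<beta> + \<gamma>)) \<le> u powr \<alpha> / (\<beta> * (\<beta> + \<gamma>))"
    using assms by (intro divide_right_mono) auto
  with assms show ?thesis
    by (auto simp: beam_green_ge intro!: mult_left_mono divide_right_mono)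
qed

theorem theorem4p2:
  fixes \<alpha> \<beta> \<gamma> :: real
  assumes "\<alpha> \<in> {0<..1}" and "\<beta> \<in> {0<..1}" and "\<gamma> \<in> {0<..1}"
  shows "\<forall>t \<in> {0..1}. \<forall>s \<in> {0..1}.
           0 \<le> beam_green \<alpha> \<beta> \<gamma> t s \<and> beam_green \<alpha> \<beta> \<gamma> t s \<le> beam_green \<alpha> \<beta> \<gamma> 1 s"
proof (intro ballI conjI)
  fix t s :: real
  assume t: "t \<in> {0..1}" and s: "s \<in> {0..1}"
  have pos: "0 < \<alpha>" "0 < \<beta>" "0 < \<gamma>" using assms by auto
  show "0 \<le> beam_green \<alpha> \<beta> \<gamma> t s"
    using beam_green_nonneg[OF pos] t s by simp
  show "beam_green \<alpha> \<beta> \<gamma> t s \<le> beam_green \<alpha> \<beta> \<gamma> 1 s"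
  proof (cases "t \<le> s")
    case True
    have "beam_green \<alpha> \<beta> \<gamma> t s \<le> beam_green \<alpha> \<beta> \<gamma> s s"
      using beam_green_le_diagonal[OF pos] t True by simp
    also have "\<dots> \<le> beam_green \<alpha> \<beta> \<gamma> 1 s"
      using beam_green_mono_above_diagonal[OF pos] s by simp
    finally show ?thesis .
  next
    case False
    thus ?thesis
      using beam_green_mono_above_diagonal[OF pos] t s by simp
  qed
qed

end
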